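(* Let $\mathcal{A}$ be the $n$-dimensional null-filiform associative algebra over $\mathbb{C}$ with basis $e_1,\dots,e_n$, and let $P_1$ be a homogeneous Nijenhuis operator with degree $1$ on $\mathcal{A}$, with associated function $\psi$. Then: (a) If $\psi(1)\neq 0$, then $P_1(e_i)=\psi(i)e_{i+1}$, where the function $\psi$ satisfies the recurrence formula \[\psi(i)=\frac{\psi(1)\psi(i-2)}{\psi(1)+\psi(i-2)-\psi(i-1)},\quad 3\le i\le n-1;\] (b) If $\psi(1)=0$ and $\psi(t)\ne 0$ for some $2\le t\le\lfloor (n-2)/2\rfloor$, then \[P_1(e_i)=\begin{cases}\frac{(t+1)\psi(t)}{i+1}e_{i+1}, & i+1\equiv 0\ (\bmod\ t+1),\\ 0,&\text{otherwise;}\end{cases}\] (c) If $\psi(t)=0$ for all $1\le t\le\lfloor (n-2)/2\rfloor$, then \[P_1(e_i)=\begin{cases}\psi(r)e_{r+1}, & i=r,\\ 0,&\text{otherwise,}\end{cases}\] for some fixed $\lfloor (n-2)/2\rfloor<r\le n-1$.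
   Context: The $n$-dimensional null-filiform associative algebra $\mathcal{A}$ over $\mathbb{C}$ has basis $e_1,\dots,e_n$ and bilinear product $e_ie_j=e_{i+j}$ if $i+j\le n$, and $e_ie_j=0$ otherwise; the symbol $e_m$ with $m>n$ is read as $0$. A homogeneous operator of degree $1$ on $\mathcal{A}$ is a linear map $P_1$ with $P_1(e_i)=\psi(i)e_{i+1}$ for $1\le i\le n-1$ and $P_1(e_n)=\psi(n)e_1$, where $\psi:\mathbb{N}\to\mathbb{C}$ is a function. A Nijenhuis operator is a linear map $P:\mathcal{A}\to\mathcal{A}$ with $P(x)P(y)=P(xP(y)+P(x)y-P(xy))$ for all $x,y\in\mathcal{A}$.
   Formalization: Assumes n≥2 (for n=1, P(e_1)=ψ(1)e_1 contradicts (a) and (c)); in (c) with n=3 also assumes ψ(1)=0 (else ψ(1)=ψ(2)=1, ψ(3)=0 is a counterexample); in (b) t is the least index with ψ(t)≠0, since the formula fails for any other such t. *)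

theory Defs
  imports Complex_Main "HOL-Number_Theory.Cong"
begin

text \<open>
  The class \<open>ring\<close> supplies an associative product without unit; the vector space structure over
  the complex numbers is given by \<open>scale\<close>. Only the values \<open>e 1, \<dots>, e n\<close> are basis vectors:
  \<open>e m\<close> is \<open>0\<close> for \<open>m > n\<close>, and \<open>e 0\<close> is an irrelevant dummy.
\<close>

locale null_filiform_algebra = vector_space scale
  for scale :: "complex \<Rightarrow> 'a::ring \<Rightarrow> 'a" +
  fixes n :: nat and e :: "nat \<Rightarrow> 'a"
  assumes scale_mult_left: "scale c x * y = scale c (x * y)"
    and scale_mult_right: "x * scale c y = scale c (x * y)"
    and basis_inj: "inj_on e {1..n}"
    and basis_independent: "independent (e ` {1..n})"
    and basis_span: "span (e ` {1..n}) = UNIV"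
    and basis_beyond: "m > n \<Longrightarrow> e m = 0"
    and basis_mult: "\<lbrakk>i \<in> {1..n}; j \<in> {1..n}\<rbrakk> \<Longrightarrow> e i * e j = (if i + j \<le> n then e (i + j) else 0)"

definition nijenhuis_operator :: "(complex \<Rightarrow> 'a::ring \<Rightarrow> 'a) \<Rightarrow> ('a \<Rightarrow> 'a) \<Rightarrow> bool" where
  "nijenhuis_operator scale P \<longleftrightarrow>
     Vector_Spaces.linear scale scale P \<and>
     (\<forall>x y. P x * P y = P (x * P y + P x * y - P (x * y)))"

definition homogeneous_degree_one ::
  "(complex \<Rightarrow> 'a::ring \<Rightarrow> 'a) \<Rightarrow> nat \<Rightarrow> (nat \<Rightarrow> 'a) \<Rightarrow> (nat \<Rightarrow> complex) \<Rightarrow> ('a \<Rightarrow> 'a) \<Rightarrow> bool" where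
  "homogeneous_degree_one scale n e \<psi> P \<longleftrightarrow>
     Vector_Spaces.linear scale scale P \<and>
     (\<forall>i\<in>{1..<n}. P (e i) = scale (\<psi> i) (e (i + 1))) \<and>
     P (e n) = scale (\<psi> n) (e 1)"

end

theory Submission imports Defs begin

text \<open>
  Evaluating the Nijenhuis identity at \<open>x = y = e n\<close> gives \<open>\<psi> n = 0\<close>. On the remaining pairs of
  basis vectors it amounts to
  \<open>\<psi> i * \<psi> j = \<psi> (i + j + 1) * (\<psi> i + \<psi> j - \<psi> (i + j))\<close> for \<open>i + j + 2 \<le> n\<close>.
  For (a) take \<open>i = 1\<close>; the denominator could vanish only if \<open>\<psi> k = 0\<close> and \<open>\<psi> (k + 1) = \<psi> 1\<close> for
  some \<open>k\<close>, but \<open>\<psi> k = 0\<close> forces \<open>k\<close> to be even and \<open>\<psi> (2 * m + 1) = \<psi> 1 / (m + 1)\<close> for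
  \<open>2 * m \<le> k\<close>. For (b) and (c) let \<open>t\<close> be the first index with \<open>\<psi> t \<noteq> 0\<close>. If \<open>t \<ge> 2\<close>, the
  pair \<open>(1, t - 1)\<close> kills \<open>\<psi> (t + 1)\<close>, and the pairs \<open>(t, j)\<close> determine all later values.
\<close>

section \<open>Scalar recurrence, over any field of characteristic zero\<close>

locale nijenhuis_recurrence =
  fixes n :: nat and \<psi> :: "nat \<Rightarrow> 'k::field_char_0"
  assumes recurrence: "\<lbrakk>1 \<le> i; 1 \<le> j; i + j + 2 \<le> n\<rbrakk> \<Longrightarrow>
    \<psi> i * \<psi> j = \<psi> (i + j + 1) * (\<psi> i + \<psi> j - \<psi> (i + j))"
begin

lemma zero_Suc_Suc:
  assumes "\<psi> 1 \<noteq> 0" and "1 \<le> k" and "k + 3 \<le> n" and "\<psi> (k + 2) = 0"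
  shows "\<psi> k = 0"
  using recurrence[of 1 k] assms by simp

text \<open>Zeros descend in steps of two by \<open>zero_Suc_Suc\<close>. The descent cannot end at
  1, where \<psi> is nonzero, so it ends at 2.\<close>

lemma zero_imp_even:
  assumes "\<psi> 1 \<noteq> 0"
  shows "\<lbrakk>1 \<le> k; k + 1 \<le> n; \<psi> k = 0\<rbrakk> \<Longrightarrow> even k \<and> \<psi> 2 = 0"
proof (induction k rule: less_induct)
  case (less k)
  have "k \<noteq> 1" using less.prems assms by auto
  then consider "k = 2" | "3 \<le> k" using less.prems by linarith
  then show ?case
  proof cases
    case 1 then show ?thesis using less.prems by simp
  next
    case 2
    then obtain m where m: "k = m + 2" "1 \<le> m" by (intro that[of "k - 2"]) auto
    have "\<psi> m = 0" using zero_Suc_Suc[of m] assms m less.prems by simp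
    then show ?thesis using less.IH[of m] m less.prems by simp
  qed
qed

text \<open>While the even values vanish, the pair (1, 2m+1) reads 1/\<psi>(2m+3) = 1/\<psi>(2m+1) +
  1/\<psi>(1), so the reciprocals of the odd values form an arithmetic progression. The pair (1,
  2m+2) then kills \<psi>(2m+4), because \<psi>(2m+3) differs from \<psi>(1). That pair needs a
  dimension one larger, hence the guard on the even half.\<close>

lemma even_zero_odd_values:
  assumes "\<psi> 1 \<noteq> 0" and "\<psi> 2 = 0"
  shows "2 * m + 2 \<le> n \<Longrightarrow>
    \<psi> (2 * m + 1) = \<psi> 1 / of_nat (m + 1) \<and> (2 * m + 3 \<le> n \<longrightarrow> \<psi> (2 * m + 2) = 0)"
proof (induction m)
  case 0
  then show ?case using assms by (simp add: numeral_2_eq_2)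
next
  case (Suc m)
  have IH: "\<psi> (2 * m + 1) = \<psi> 1 / of_nat (m + 1)" "\<psi> (2 * m + 2) = 0"
    using Suc by auto
  have nz: "of_nat (m + 1) \<noteq> (0 :: 'k)" "of_nat (m + 2) \<noteq> (0 :: 'k)"
    by (simp_all only: of_nat_eq_0_iff)
  have odd: "\<psi> (2 * m + 3) = \<psi> 1 / of_nat (m + 2)"
  proof -
    have "\<psi> 1 * \<psi> (2 * m + 1) = \<psi> (2 * m + 3) * (\<psi> 1 + \<psi> (2 * m + 1))"
      using recurrence[of 1 "2 * m + 1"] Suc.prems IH(2) by (simp add: eval_nat_numeral)
    then have "\<psi> 1 * \<psi> 1 = \<psi> (2 * m + 3) * (\<psi> 1 * of_nat (m + 2))"
      using nz unfolding IH(1) by (simp add: field_simps)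
    then have "\<psi> 1 * \<psi> 1 = \<psi> 1 * (\<psi> (2 * m + 3) * of_nat (m + 2))"
      by (simp only: mult.left_commute)
    then have "\<psi> 1 = \<psi> (2 * m + 3) * of_nat (m + 2)"
      using assms(1) by (metis mult_cancel_left)
    then show ?thesis using nz by (metis nonzero_mult_div_cancel_right)
  qed
  have even: "\<psi> (2 * m + 4) = 0" if "2 * m + 5 \<le> n"
  proof -
    have "0 = \<psi> (2 * m + 4) * (\<psi> 1 - \<psi> (2 * m + 3))"
      using recurrence[of 1 "2 * m + 2"] that IH(2) by (simp add: eval_nat_numeral)
    moreover have "\<psi> 1 - \<psi> (2 * m + 3) \<noteq> 0"
    proof
      assume "\<psi> 1 - \<psi> (2 * m + 3) = 0"
      then have "\<psi> 1 * of_nat (m + 2) = \<psi> 1 * of_nat 1"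
        using odd nz by (simp add: field_simps)
      then have "of_nat (m + 2) = (of_nat 1 :: 'k)" using assms(1) by (metis mult_cancel_left)
      then show False by (simp only: of_nat_eq_iff)
    qed
    ultimately show ?thesis by simp
  qed
  show ?case using odd even by (simp add: eval_nat_numeral)
qed

text \<open>Division by zero yields zero in HOL, and the recurrence says nothing about its leading
  factor when the other factor vanishes. The quotient in (a) therefore rests on this fact.\<close>

lemma denominator_nonzero:
  assumes "\<psi> 1 \<noteq> 0" and "1 \<le> k" and "k + 3 \<le> n"
  shows "\<psi> 1 + \<psi> k - \<psi> (k + 1) \<noteq> 0"
proof
  assume *: "\<psi> 1 + \<psi> k - \<psi> (k + 1) = 0"
  have "\<psi> 1 * \<psi> k = 0" using recurrence[of 1 k] assms * by simp
  then have k0: "\<psi> k = 0" using assms by simp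
  then have "even k" and "\<psi> 2 = 0" using zero_imp_even assms by auto
  then obtain m where m: "k = 2 * m" by blast
  have "\<psi> (k + 1) = \<psi> 1 / of_nat (m + 1)"
    using even_zero_odd_values[of m] m assms \<open>\<psi> 2 = 0\<close> by simp
  moreover have "\<psi> (k + 1) = \<psi> 1" using * k0 by simp
  moreover have "of_nat (m + 1) \<noteq> (0 :: 'k)" by (simp only: of_nat_eq_0_iff)
  ultimately have "\<psi> 1 * of_nat (m + 1) = \<psi> 1 * of_nat 1" by (simp add: field_simps)
  then have "of_nat (m + 1) = (of_nat 1 :: 'k)" using assms(1) by (metis mult_cancel_left)
  then have "m = 0" by (simp only: of_nat_eq_iff)
  then show False using m assms by simp
qed

text \<open>Pairs (t, j) with j \<ge> 1 only reach indices from t + 2 on, so t + 1 needs its own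
  pair. In (1, t - 1) both values vanish, which leaves 0 = -\<psi>(t+1) \<psi>(t).\<close>

lemma next_zero:
  assumes "2 \<le> t" and "t + 2 \<le> n" and "\<psi> t \<noteq> 0" and "\<And>s. \<lbrakk>1 \<le> s; s < t\<rbrakk> \<Longrightarrow> \<psi> s = 0"
  shows "\<psi> (t + 1) = 0"
  using recurrence[of 1 "t - 1"] assms by simp

text \<open>Strong induction: the pair (t, j) expresses \<psi>(t+j+1) through \<psi>(j) and
  \<psi>(t+j). If t + 1 divides j + 1, then \<psi>(t+j) = 0 and the relation is 1/\<psi>(i) =
  1/\<psi>(t) + 1/\<psi>(j) with i = t + j + 1; otherwise \<psi>(j) = 0 forces \<psi>(i) =
  0.\<close>

lemma values_from_first_nonzero:
  assumes "2 \<le> t" and "\<psi> t \<noteq> 0" and zero: "\<And>s. \<lbrakk>1 \<le> s; s < t\<rbrakk> \<Longrightarrow> \<psi> s = 0"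
  shows "\<lbrakk>1 \<le> i; i + 1 \<le> n\<rbrakk> \<Longrightarrow>
    \<psi> i = (if (t + 1) dvd (i + 1) then of_nat (t + 1) * \<psi> t / of_nat (i + 1) else 0)"
proof (induction i rule: less_induct)
  case (less i)
  have t1: "of_nat (t + 1) \<noteq> (0 :: 'k)" by (simp only: of_nat_eq_0_iff)
  consider "i < t" | "i = t" | "i = t + 1" | j where "1 \<le> j" "i = t + j + 1"
    using less_imp_Suc_add[of "t + 1" i] by (cases "t + 1 < i") fastforce+
  then show ?case
  proof cases
    case 1
    then have "\<not> (t + 1) dvd (i + 1)" by (intro nat_dvd_not_less) auto
    with 1 zero less.prems show ?thesis by simp
  next
    case 2
    with t1 show ?thesis by (simp del: of_nat_add of_nat_Suc)
  next
    case 3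
    have "\<not> (t + 1) dvd (t + 1 + 1)"
      using dvd_add_right_iff[of "t + 1" "t + 1" 1] \<open>2 \<le> t\<close> by simp
    moreover have "\<psi> i = 0" using next_zero 3 assms less.prems by simp
    ultimately show ?thesis using 3 by simp
  next
    case (4 j)
    have rec: "\<psi> t * \<psi> j = \<psi> i * (\<psi> t + \<psi> j - \<psi> (t + j))"
      using recurrence[of t j] 4 less.prems \<open>2 \<le> t\<close> by simp
    have IHj: "\<psi> j = (if (t + 1) dvd (j + 1) then of_nat (t + 1) * \<psi> t / of_nat (j + 1) else 0)"
      using less.IH[of j] 4 less.prems by simp
    have IHtj: "\<psi> (t + j) =
        (if (t + 1) dvd (t + j + 1) then of_nat (t + 1) * \<psi> t / of_nat (t + j + 1) else 0)"
      using less.IH[of "t + j"] 4 less.prems by simp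
    have shift: "(t + 1) dvd (i + 1) \<longleftrightarrow> (t + 1) dvd (j + 1)"
      using dvd_add_right_iff[of "t + 1" "t + 1" "j + 1"] 4 by (simp add: algebra_simps)
    have shift': "(t + 1) dvd (t + j + 1) \<longleftrightarrow> (t + 1) dvd j"
      using dvd_add_right_iff[of "t + 1" "t + 1" j] by (simp add: algebra_simps)
    have nz: "of_nat (j + 1) \<noteq> (0 :: 'k)" "of_nat (i + 1) \<noteq> (0 :: 'k)" "of_nat (t + j + 1) \<noteq> (0 :: 'k)"
      by (simp_all only: of_nat_eq_0_iff)
    show ?thesis
    proof (cases "(t + 1) dvd (j + 1)")
      case True
      have "\<not> (t + 1) dvd j"
        using True dvd_add_right_iff[of "t + 1" j 1] \<open>2 \<le> t\<close> by auto
      then have "\<psi> (t + j) = 0" using IHtj shift' by simp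
      moreover have pj: "\<psi> j = of_nat (t + 1) * \<psi> t / of_nat (j + 1)" using IHj True by simp
      ultimately have "\<psi> t * \<psi> j = \<psi> i * (\<psi> t + \<psi> j)" using rec by simp
      moreover have pj': "of_nat (t + 1) * \<psi> t = \<psi> j * of_nat (j + 1)"
        using pj nz by (metis nonzero_eq_divide_eq)
      ultimately have "\<psi> t * (of_nat (t + 1) * \<psi> t) = \<psi> i * (\<psi> t + \<psi> j) * of_nat (j + 1)"
        by (metis mult.assoc)
      also have "\<dots> = \<psi> i * (\<psi> t * of_nat (j + 1) + of_nat (t + 1) * \<psi> t)"
        unfolding pj' by (simp only: distrib_right mult.assoc)
      \<comment> \<open>The numerators add up because i + 1 = (t + 1) + (j + 1).\<close>
      also have "\<dots> = \<psi> t * (\<psi> i * of_nat (i + 1))"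
        using 4 by (simp add: algebra_simps)
      finally have "of_nat (t + 1) * \<psi> t = \<psi> i * of_nat (i + 1)"
        using \<open>\<psi> t \<noteq> 0\<close> by (simp only: mult_cancel_left) simp
      then show ?thesis using True shift nz by (simp add: field_simps del: of_nat_add of_nat_Suc)
    next
      case False
      then have "\<psi> j = 0" using IHj by simp
      \<comment> \<open>By induction \<psi>(t+j) is either 0 or \<psi>(t) scaled by (t+1)/(t+j+1),
        which is not 1 since j \<ge> 1.\<close>
      moreover have "\<psi> (t + j) \<noteq> \<psi> t"
      proof
        assume eq: "\<psi> (t + j) = \<psi> t"
        then have "of_nat (t + 1) * \<psi> t / of_nat (t + j + 1) = \<psi> t"
          using IHtj \<open>\<psi> t \<noteq> 0\<close> by (metis (full_types))
        then have "\<psi> t * of_nat (t + 1) = \<psi> t * of_nat (t + j + 1)"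
          using nz by (simp add: field_simps del: of_nat_add of_nat_Suc)
        then have "of_nat (t + 1) = (of_nat (t + j + 1) :: 'k)"
          using \<open>\<psi> t \<noteq> 0\<close> by (metis mult_cancel_left)
        then have "t + 1 = t + j + 1" by (simp only: of_nat_eq_iff)
        then show False using 4 by simp
      qed
      ultimately have "\<psi> i = 0" using rec by simp
      then show ?thesis using False shift by simp
    qed
  qed
qed

text \<open>The first nonzero index r is so large that the next multiple of r + 1 after r + 1 itself
  exceeds n, so the divisibility pattern has a single member. For n = 3 the recurrence has no
  instance and \<psi>(1), \<psi>(2) could both be nonzero, hence the extra hypothesis.\<close>

lemma unique_nonzero:
  assumes small: "\<And>s. \<lbrakk>1 \<le> s; s \<le> (n - 2) div 2\<rbrakk> \<Longrightarrow> \<psi> s = 0"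
    and "n = 3 \<Longrightarrow> \<psi> 1 = 0" and "2 \<le> n"
  shows "\<exists>r\<in>{(n - 2) div 2<..n - 1}. \<forall>i\<in>{1..n - 1}. i \<noteq> r \<longrightarrow> \<psi> i = 0"
proof (cases "\<exists>i\<in>{1..n - 1}. \<psi> i \<noteq> 0")
  case False
  \<comment> \<open>If all values vanish, any admissible r serves.\<close>
  with \<open>2 \<le> n\<close> show ?thesis by (intro bexI[of _ "n - 1"]) auto
next
  case True
  define r where "r = (LEAST i. 1 \<le> i \<and> i + 1 \<le> n \<and> \<psi> i \<noteq> 0)"
  have ex: "\<exists>i. 1 \<le> i \<and> i + 1 \<le> n \<and> \<psi> i \<noteq> 0" using True by force
  have r: "1 \<le> r" "r + 1 \<le> n" "\<psi> r \<noteq> 0"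
    using LeastI_ex[OF ex] unfolding r_def by auto
  have below: "\<psi> s = 0" if "1 \<le> s" "s < r" for s
    using not_less_Least[of s "\<lambda>i. 1 \<le> i \<and> i + 1 \<le> n \<and> \<psi> i \<noteq> 0"] that r
    unfolding r_def[symmetric] by auto
  have big: "(n - 2) div 2 < r" using small[of r] r by (meson not_le)
  have "\<psi> s = 0" if "1 \<le> s" "s + 1 \<le> n" "s \<noteq> r" for s
  proof (cases "s < r")
    case True with below that show ?thesis by simp
  next
    case False
    \<comment> \<open>If r = 1, then \<open>big\<close> leaves only n = 2 or n = 3; the latter is
      excluded, and the former has no room for s > 1.\<close>
    have r2: "2 \<le> r"
    proof (rule ccontr)
      assume "\<not> 2 \<le> r"
      then have "r = 1" using r by simp
      moreover then have "n \<noteq> 3" using assms(2) r by auto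
      ultimately show False using big False that by auto
    qed
    have "\<not> (r + 1) dvd (s + 1)"
    proof
      assume "(r + 1) dvd (s + 1)"
      then obtain k where k: "s + 1 = (r + 1) * k" by blast
      have "2 \<le> k" using k False that by (cases k; cases "k = 1") auto
      then have "2 * (r + 1) \<le> s + 1" using k by (metis mult.commute mult_le_mono2)
      \<comment> \<open>Equality occurs for odd n \<ge> 3. Together with \<open>big\<close> this
        gives n < 2(r + 1).\<close>
      moreover have "n \<le> 2 * ((n - 2) div 2) + 3" by simp
      ultimately show False using big that by presburger
    qed
    then show ?thesis using values_from_first_nonzero[of r s] r2 r below that by simp
  qed
  with r big show ?thesis by (intro bexI[of _ r]) auto
qed

end

section \<open>From the algebra to the recurrence\<close>

context null_filiform_algebra
begin

lemma basis_nonzero: "i \<in> {1..n} \<Longrightarrow> e i \<noteq> 0"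
  using basis_independent dependent_zero[of "e ` {1..n}"] by (metis image_eqI)

context
  fixes \<psi> :: "nat \<Rightarrow> complex" and P :: "'a \<Rightarrow> 'a"
  assumes dim: "2 \<le> n"
    and homogeneous: "homogeneous_degree_one scale n e \<psi> P"
    and nijenhuis: "nijenhuis_operator scale P"
begin

interpretation P: Vector_Spaces.linear scale scale P
  using homogeneous by (simp add: homogeneous_degree_one_def)

lemma nijenhuis_identity: "P x * P y = P (x * P y + P x * y - P (x * y))"
  using nijenhuis by (simp add: nijenhuis_operator_def)

text \<open>As \<open>e n\<close> annihilates the algebra, the right side of the identity is P(0),
  while the left side is \<psi>(n)^2 times \<open>e 2\<close>, a basis vector since n \<ge>
  2.\<close>

lemma last_zero: "\<psi> n = 0"
proof -
  have Pn: "P (e n) = scale (\<psi> n) (e 1)"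
    using homogeneous by (simp add: homogeneous_degree_one_def)
  have "P (e n) * P (e n) = 0"
    unfolding nijenhuis_identity[of "e n" "e n"] using dim
    by (simp add: Pn scale_mult_left scale_mult_right basis_mult P.zero)
  then have "scale (\<psi> n * \<psi> n) (e 2) = 0"
    using dim by (simp add: Pn scale_mult_left scale_mult_right basis_mult numeral_2_eq_2)
  then show ?thesis using basis_nonzero[of 2] dim by simp
qed

text \<open>With \<psi>(n) = 0 the wrap-around to \<open>e 1\<close> disappears. Since
  \<open>e m\<close> vanishes beyond n, one formula covers all i \<ge> 1 without a case
  split.\<close>

lemma P_basis: "1 \<le> i \<Longrightarrow> P (e i) = scale (\<psi> i) (e (i + 1))"
  using homogeneous last_zero basis_beyond[of i] basis_beyond[of "i + 1"] P.zero
  by (cases i n rule: linorder_cases) (auto simp: homogeneous_degree_one_def)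

text \<open>Compare coefficients of \<open>e (i + j + 2)\<close> in the identity for
  \<open>e i\<close> and \<open>e j\<close>; the bound i + j + 2 \<le> n ensures that this vector is
  nonzero.\<close>

lemma nijenhuis_recurrence: "nijenhuis_recurrence n \<psi>"
proof
  fix i j :: nat
  assume ij: "1 \<le> i" "1 \<le> j" "i + j + 2 \<le> n"
  have "scale (\<psi> i * \<psi> j) (e (i + j + 2)) = P (e i) * P (e j)"
    using ij by (simp add: P_basis scale_mult_left scale_mult_right basis_mult)
  also have "\<dots> = P (scale (\<psi> i + \<psi> j - \<psi> (i + j)) (e (i + j + 1)))"
    unfolding nijenhuis_identity[of "e i" "e j"] using ij
    by (simp add: P_basis scale_mult_left scale_mult_right basis_mult
        scale_left_distrib scale_left_diff_distrib add.commute)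
  also have "\<dots> = scale (\<psi> (i + j + 1) * (\<psi> i + \<psi> j - \<psi> (i + j))) (e (i + j + 2))"
    using P_basis[of "i + j + 1"] by (simp add: P.scale mult.commute)
  finally show "\<psi> i * \<psi> j = \<psi> (i + j + 1) * (\<psi> i + \<psi> j - \<psi> (i + j))"
    using basis_nonzero[of "i + j + 2"] ij by simp
qed

end

end

text \<open>In (b) the index t has to be the first one with \<psi>(t) nonzero: a later index u with
  \<psi>(u) nonzero would give a formula that wrongly sends \<open>e t\<close> to 0. In (c) the
  clause for n = 3 excludes the case where the range of t is empty and two values may be
  nonzero.\<close>

theorem theorem3p15:
  fixes scale :: "complex \<Rightarrow> 'a::ring \<Rightarrow> 'a"
    and n :: nat
    and e :: "nat \<Rightarrow> 'a"
    and \<psi> :: "nat \<Rightarrow> complex"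
    and P :: "'a \<Rightarrow> 'a"
  assumes "n \<ge> 2"
    and "null_filiform_algebra scale n e"
    and "homogeneous_degree_one scale n e \<psi> P"
    and "nijenhuis_operator scale P"
  shows "(\<psi> 1 \<noteq> 0 \<longrightarrow>
            (\<forall>i\<in>{1..n}. P (e i) = scale (\<psi> i) (e (i + 1))) \<and>
            (\<forall>i\<in>{3..n - 1}.
               \<psi> 1 + \<psi> (i - 2) - \<psi> (i - 1) \<noteq> 0 \<and>
               \<psi> i = \<psi> 1 * \<psi> (i - 2) / (\<psi> 1 + \<psi> (i - 2) - \<psi> (i - 1))))
       \<and> (\<psi> 1 = 0 \<and> (\<exists>t\<in>{2..(n - 2) div 2}. \<psi> t \<noteq> 0) \<longrightarrow>
            (\<exists>t\<in>{2..(n - 2) div 2}. \<psi> t \<noteq> 0 \<and> (\<forall>s\<in>{1..<t}. \<psi> s = 0) \<and>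
               (\<forall>i\<in>{1..n}. P (e i) =
                  (if [i + 1 = 0] (mod (t + 1))
                   then scale (of_nat (t + 1) * \<psi> t / of_nat (i + 1)) (e (i + 1))
                   else 0))))
       \<and> ((\<forall>t\<in>{1..(n - 2) div 2}. \<psi> t = 0) \<and> (n = 3 \<longrightarrow> \<psi> 1 = 0) \<longrightarrow>
            (\<exists>r\<in>{(n - 2) div 2<..n - 1}.
               (\<forall>i\<in>{1..n}. P (e i) = (if i = r then scale (\<psi> r) (e (r + 1)) else 0))))"
proof -
  interpret null_filiform_algebra scale n e by fact
  interpret R: nijenhuis_recurrence n \<psi>
    using nijenhuis_recurrence assms by blast
  have P: "P (e i) = scale (\<psi> i) (e (i + 1))" if "i \<in> {1..n}" for i
    using P_basis[OF assms(1,3,4)] that by simp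
  have P_last: "P (e n) = 0"
    using P[of n] assms(1) basis_beyond[of "n + 1"] by simp
  show ?thesis
  proof (intro conjI impI)
    assume "\<psi> 1 \<noteq> 0"
    show "\<forall>i\<in>{1..n}. P (e i) = scale (\<psi> i) (e (i + 1))" using P by blast
    show "\<forall>i\<in>{3..n - 1}. \<psi> 1 + \<psi> (i - 2) - \<psi> (i - 1) \<noteq> 0 \<and>
      \<psi> i = \<psi> 1 * \<psi> (i - 2) / (\<psi> 1 + \<psi> (i - 2) - \<psi> (i - 1))"
    proof
      fix i assume "i \<in> {3..n - 1}"
      then obtain k where k: "i = k + 2" "1 \<le> k" "k + 3 \<le> n"
        by (intro that[of "i - 2"]) auto
      have "\<psi> 1 + \<psi> k - \<psi> (k + 1) \<noteq> 0"
        using R.denominator_nonzero \<open>\<psi> 1 \<noteq> 0\<close> k by blast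
      then show "\<psi> 1 + \<psi> (i - 2) - \<psi> (i - 1) \<noteq> 0 \<and>
          \<psi> i = \<psi> 1 * \<psi> (i - 2) / (\<psi> 1 + \<psi> (i - 2) - \<psi> (i - 1))"
        using R.recurrence[of 1 k] k by (simp add: eq_divide_eq)
    qed
  next
    assume b: "\<psi> 1 = 0 \<and> (\<exists>t\<in>{2..(n - 2) div 2}. \<psi> t \<noteq> 0)"
    \<comment> \<open>The given index u only shows that t exists and bounds it from above.\<close>
    define t where "t = (LEAST t. 1 \<le> t \<and> \<psi> t \<noteq> 0)"
    obtain u where u: "2 \<le> u" "u \<le> (n - 2) div 2" "\<psi> u \<noteq> 0" using b by auto
    have "1 \<le> t \<and> \<psi> t \<noteq> 0" and "t \<le> u"
      using LeastI[of "\<lambda>t. 1 \<le> t \<and> \<psi> t \<noteq> 0" u] Least_le[of "\<lambda>t. 1 \<le> t \<and> \<psi> t \<noteq> 0" u] u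
      unfolding t_def by auto
    moreover from this have "t \<noteq> 1" using b by metis
    ultimately have t: "2 \<le> t" "t \<le> (n - 2) div 2" "\<psi> t \<noteq> 0" using u by auto
    have below: "\<psi> s = 0" if "1 \<le> s" "s < t" for s
      using not_less_Least[of s "\<lambda>t. 1 \<le> t \<and> \<psi> t \<noteq> 0"] that unfolding t_def by auto
    have "P (e i) = (if [i + 1 = 0] (mod (t + 1))
        then scale (of_nat (t + 1) * \<psi> t / of_nat (i + 1)) (e (i + 1)) else 0)"
      if i: "i \<in> {1..n}" for i
    \<comment> \<open>If t + 1 divides n + 1, the claimed coefficient at i = n is not \<psi>(n) = 0;
      both sides still agree because \<open>e (n + 1)\<close> is 0.\<close>
    proof (cases "i = n")
      case True
      then show ?thesis using P_last basis_beyond[of "n + 1"] by simp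
    next
      case False
      then show ?thesis
        using P[OF i] R.values_from_first_nonzero[of t i] t below i
        by (simp add: cong_0_iff del: of_nat_add of_nat_Suc)
    qed
    with t below show "\<exists>t\<in>{2..(n - 2) div 2}. \<psi> t \<noteq> 0 \<and> (\<forall>s\<in>{1..<t}. \<psi> s = 0) \<and>
      (\<forall>i\<in>{1..n}. P (e i) = (if [i + 1 = 0] (mod (t + 1))
        then scale (of_nat (t + 1) * \<psi> t / of_nat (i + 1)) (e (i + 1)) else 0))"
      by (intro bexI[of _ t]) auto
  next
    assume c: "(\<forall>t\<in>{1..(n - 2) div 2}. \<psi> t = 0) \<and> (n = 3 \<longrightarrow> \<psi> 1 = 0)"
    obtain r where r: "r \<in> {(n - 2) div 2<..n - 1}" "\<forall>i\<in>{1..n - 1}. i \<noteq> r \<longrightarrow> \<psi> i = 0"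
      using R.unique_nonzero c assms(1) by auto
    have "P (e i) = (if i = r then scale (\<psi> r) (e (r + 1)) else 0)" if i: "i \<in> {1..n}" for i
      using P[OF i] P_last r i by (cases "i = n") auto
    with r(1) show "\<exists>r\<in>{(n - 2) div 2<..n - 1}.
      \<forall>i\<in>{1..n}. P (e i) = (if i = r then scale (\<psi> r) (e (r + 1)) else 0)"
      by blast
  qed
qed

end
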